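(* Let $N\geq 3$ be an integer, $2^{*}:=2N/(N-2)$, $A>0$, $0<\alpha<2$ and $\frac{2N}{N-\alpha}<p<2^{*}$. Assume that $u$ is a radial (classical) solution of $$-\triangle u+\frac{A}{|x|^{\alpha}}u=u^{p-1}\ \text{ in }\mathbb{R}^{N}\setminus\{0\},\qquad u>0\ \text{ in }\mathbb{R}^{N}\setminus\{0\},\qquad u\in H_{\alpha}^{1}.$$ Then, as $x\to 0$, $$u(x)=\begin{cases} O(1) & \text{if } p<2^{*}-1,\\ O(\ln|x|) & \text{if } p=2^{*}-1,\\ O\!\left(|x|^{-\frac{N-2}{2}(p-2^{*}+1)}\right) & \text{if } p>2^{*}-1.\end{cases}$$
   Context: Here $D^{1,2}(\mathbb{R}^{N})=\{u\in L^{2^{*}}(\mathbb{R}^{N}):\nabla u\in L^{2}(\mathbb{R}^{N})\}$ (gradient in the weak sense) and $H_{\alpha}^{1}:=D^{1,2}(\mathbb{R}^{N})\cap L^{2}(\mathbb{R}^{N},|x|^{-\alpha}dx)$. "Classical solution" means $u\in C^{2}(\mathbb{R}^{N}\setminus\{0\})$ satisfying the equation pointwise in $\mathbb{R}^{N}\setminus\{0\}$ together with the positivity and integrability conditions. "Radial" means $u(x)=\phi(|x|)$ for some function $\phi:(0,+\infty)\to\mathbb{R}$. $O$ is the usual Landau symbol. *)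

theory Defs
  imports "HOL-Analysis.Analysis" "HOL-Library.Landau_Symbols"
begin

definition partial_deriv :: "'a::euclidean_space \<Rightarrow> ('a \<Rightarrow> real) \<Rightarrow> 'a \<Rightarrow> real" where
  "partial_deriv i f x = frechet_derivative f (at x) i"

text \<open>Only meant for open \<open>S\<close>, since the derivatives are taken with respect to the whole space.\<close>

primrec Ck_on :: "nat \<Rightarrow> 'a::euclidean_space set \<Rightarrow> ('a \<Rightarrow> real) \<Rightarrow> bool" where
  "Ck_on 0 S f = continuous_on S f"
| "Ck_on (Suc k) S f =
     ((\<forall>x\<in>S. f differentiable (at x)) \<and> (\<forall>i\<in>Basis. Ck_on k S (partial_deriv i f)))"

definition laplacian :: "('a::euclidean_space \<Rightarrow> real) \<Rightarrow> 'a \<Rightarrow> real" where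
  "laplacian f x = (\<Sum>i\<in>Basis. partial_deriv i (partial_deriv i f) x)"

definition test_function :: "('a::euclidean_space \<Rightarrow> real) \<Rightarrow> bool" where
  "test_function \<phi> \<longleftrightarrow> (\<forall>k. Ck_on k UNIV \<phi>) \<and> compact (closure {x. \<phi> x \<noteq> 0})"

definition locally_integrable ::
    "('a::euclidean_space \<Rightarrow> 'b::{banach, second_countable_topology}) \<Rightarrow> bool" where
  "locally_integrable f \<longleftrightarrow> (\<forall>K. compact K \<longrightarrow> set_integrable lebesgue K f)"

definition has_weak_gradient ::
    "('a::euclidean_space \<Rightarrow> real) \<Rightarrow> ('a \<Rightarrow> 'a) \<Rightarrow> bool" where
  "has_weak_gradient u g \<longleftrightarrow>
     locally_integrable u \<and> locally_integrable g \<and>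
     (\<forall>\<phi>. test_function \<phi> \<longrightarrow>
       (\<forall>i\<in>Basis. (LINT x|lebesgue. u x * partial_deriv i \<phi> x)
                  = - (LINT x|lebesgue. (g x \<bullet> i) * \<phi> x)))"

definition Lp_space :: "'a measure \<Rightarrow> real \<Rightarrow> ('a \<Rightarrow> 'b::real_normed_vector) set" where
  "Lp_space M q = {f \<in> borel_measurable M. integrable M (\<lambda>x. norm (f x) powr q)}"

definition critical_exponent :: "nat \<Rightarrow> real" where
  "critical_exponent N = 2 * real N / (real N - 2)"

definition D12 :: "('a::euclidean_space \<Rightarrow> real) set" where
  "D12 = {u \<in> Lp_space lebesgue (critical_exponent DIM('a)).
            \<exists>g. has_weak_gradient u g \<and> g \<in> Lp_space lebesgue 2}"

definition H1_weighted :: "real \<Rightarrow> ('a::euclidean_space \<Rightarrow> real) set" where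
  "H1_weighted \<alpha> =
     D12 \<inter> Lp_space (density lebesgue (\<lambda>x. ennreal (norm x powr (- \<alpha>)))) 2"

text \<open>Functions are total, so the value at the origin is an arbitrary real number;
  nothing below depends on it.\<close>

definition classical_solution ::
    "real \<Rightarrow> real \<Rightarrow> real \<Rightarrow> ('a::euclidean_space \<Rightarrow> real) \<Rightarrow> bool" where
  "classical_solution A \<alpha> p u \<longleftrightarrow>
     Ck_on 2 (- {0}) u \<and>
     (\<forall>x. x \<noteq> 0 \<longrightarrow> - laplacian u x + A / (norm x powr \<alpha>) * u x = u x powr (p - 1)) \<and>
     (\<forall>x. x \<noteq> 0 \<longrightarrow> u x > 0) \<and>
     u \<in> H1_weighted \<alpha>"

definition radial :: "('a::euclidean_space \<Rightarrow> real) \<Rightarrow> bool" where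
  "radial u \<longleftrightarrow> (\<exists>\<phi>::real \<Rightarrow> real. \<forall>x. x \<noteq> 0 \<longrightarrow> u x = \<phi> (norm x))"

end

theory Submission imports Defs begin

text \<open>
  Write \<open>u(x) = f(|x|)\<close>, \<open>q = 2N/(N-2)\<close> and \<open>\<beta> = (N-2)(p-1)/2\<close>, so that the exponent in the
  claim is \<open>(N-2)(p-q+1)/2 = \<beta> - 2\<close> and the three cases are \<open>\<beta> < 2\<close>, \<open>\<beta> = 2\<close> and
  \<open>\<beta> > 2\<close>. In divergence form the equation bounds the flux \<open>w(r) = r^(N-1) f'(r)\<close>
  from one side: the potential term is nonnegative, hence \<open>w' \<ge> - r^(N-1) f^(p-1)\<close>.

  The integrability \<open>u \<in> L^q\<close>, which in polar coordinates reads
  \<open>\<integral> t^(N-1) f^q dt < \<infinity>\<close> (\<open>radial_integral_bound\<close>), enters twice.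

  \<^item> Since \<open>p - 1 < q\<close>, a Hoelder-type estimate shows that the integral of
    \<open>t^(N-1) f^(p-1)\<close> over \<open>(0, r]\<close> is \<open>O(r^(N-\<beta>))\<close>, so \<open>w\<close> cannot drop by more
    than \<open>C r^(N-\<beta>)\<close> on \<open>(0, r]\<close> (\<open>flux_increment_bound\<close>).
  \<^item> The flux cannot stay below a negative constant near \<open>0\<close>, for then \<open>f\<close> would grow at least
    like the fundamental solution \<open>r^(2-N)\<close>, which is not in \<open>L^q\<close> at the origin
    (\<open>flux_not_bounded_away_below\<close>).

  Together these give \<open>w(r) \<ge> - C r^(N-\<beta>)\<close>, that is \<open>f'(r) \<ge> - C r^(1-\<beta>)\<close>
  (\<open>radial_solution_derivative_bound\<close>), and integrating from \<open>r\<close> to \<open>1\<close> bounds \<open>f(r)\<close> by a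
  constant, by \<open>|ln r|\<close> or by \<open>r^(2-\<beta>)\<close>, according to the position of \<open>\<beta>\<close> relative to \<open>2\<close>.
\<close>

section \<open>Integration of radial functions\<close>

text \<open>
  Polar coordinates for radial functions. The image of Lebesgue measure under the norm is determined
  by the volumes of balls, and its density is the derivative of \<open>r \<mapsto> \<omega> r^n\<close>.
\<close>

lemma distr_norm_lborel:
  "distr (lborel :: 'a::euclidean_space measure) borel norm =
   density lborel (\<lambda>t. ennreal (real DIM('a) * unit_ball_vol (real DIM('a)) * t ^ (DIM('a) - 1))
                       * indicator {0..} t)"
proof (rule measure_eqI_generator_eq)
  let ?n = "DIM('a)" and ?\<omega> = "unit_ball_vol (real DIM('a))"
  let ?M = "distr (lborel :: 'a measure) borel norm"
  let ?N = "density lborel (\<lambda>t. ennreal (real ?n * ?\<omega> * t ^ (?n - 1)) * indicator {0..} t)"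
  let ?E = "range (\<lambda>a::real. {..a})"
  show "Int_stable ?E" by (auto simp: Int_stable_def)
  show "?E \<subseteq> Pow UNIV" by simp
  show "sets ?M = sigma_sets UNIV ?E" "sets ?N = sigma_sets UNIV ?E"
    by (simp_all add: borel_eq_atMost)
  have M: "emeasure ?M {..a} = (if a < 0 then 0 else ennreal (?\<omega> * a ^ ?n))" for a
  proof -
    have "norm -` {..a} = cball (0::'a) a" by auto
    then have *: "emeasure ?M {..a} = emeasure lborel (cball (0::'a) a)"
      by (simp add: emeasure_distr)
    show ?thesis
    proof (cases "a < 0")
      case True
      then have "cball (0::'a) a = {}" by simp
      then show ?thesis using * True by simp
    next
      case False
      then show ?thesis using * by (simp add: emeasure_cball)
    qed
  qed
  have N: "emeasure ?N {..a} = (if a < 0 then 0 else ennreal (?\<omega> * a ^ ?n))" for a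
  proof -
    have "emeasure ?N {..a} =
        (\<integral>\<^sup>+t. ennreal (real ?n * ?\<omega> * t ^ (?n - 1)) * indicator {0..a} t \<partial>lborel)"
      by (subst emeasure_density) (auto intro!: nn_integral_cong split: split_indicator)
    also have "\<dots> = (if a < 0 then 0 else ennreal (?\<omega> * a ^ ?n))"
    proof (cases "a < 0")
      case False
      have "(\<integral>\<^sup>+t. ennreal (real ?n * ?\<omega> * t ^ (?n - 1)) * indicator {0..a} t \<partial>lborel)
          = ?\<omega> * a ^ ?n - ?\<omega> * 0 ^ ?n"
        using False
        by (intro nn_integral_FTC_Icc) (auto intro!: derivative_eq_intros mult_nonneg_nonneg)
      then show ?thesis using False by (simp add: power_0_left)
    qed simp
    finally show ?thesis .
  qed
  show "emeasure ?M X = emeasure ?N X" if "X \<in> ?E" for X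
    using that M N by force
  show "range (\<lambda>k::nat. {..real k}) \<subseteq> ?E" by auto
  show "(\<Union>k::nat. {..real k}) = UNIV"
    by (auto simp: real_arch_simple)
  show "emeasure ?M {..real k} \<noteq> \<infinity>" for k
    by (simp add: M)
qed

text \<open>
  The bound is uniform over intervals that stay away from \<open>0\<close>, where the integrand is continuous;
  this uniformity expresses that the radial integral converges at the origin.
\<close>

lemma radial_integral_bound:
  fixes u :: "'a::euclidean_space \<Rightarrow> real" and f :: "real \<Rightarrow> real" and q :: real
  assumes u: "u \<in> Lp_space lebesgue q"
    and uf: "\<And>x. x \<noteq> 0 \<Longrightarrow> u x = f (norm x)"
    and f: "continuous_on {0<..} f" "\<And>t. t > 0 \<Longrightarrow> f t > 0"
  shows "\<exists>K. \<forall>s r. 0 < s \<longrightarrow> s \<le> r \<longrightarrow>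
           integral {s..r} (\<lambda>t. t powr (real DIM('a) - 1) * f t powr q) \<le> K"
proof -
  let ?n = "DIM('a)"
  define c where "c = real ?n * unit_ball_vol (real ?n)"
  have c: "c > 0" by (simp add: c_def)
  define I where "I = (\<integral>x. norm (u x) powr q \<partial>lebesgue)"
  have int: "integrable lebesgue (\<lambda>x. norm (u x) powr q)"
    using u by (simp add: Lp_space_def)
  have I: "(\<integral>\<^sup>+x. ennreal (norm (u x) powr q) \<partial>lebesgue) = ennreal I"
    unfolding I_def by (intro nn_integral_eq_integral int) simp
  have "I \<ge> 0" by (simp add: I_def)
  have "integral {s..r} (\<lambda>t. t powr (real ?n - 1) * f t powr q) \<le> I / c"
    if s: "0 < s" "s \<le> r" for s r
  proof -
    define h where "h t = indicator {s..r} t * f t powr q" for t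
    have fnz: "f t \<noteq> 0" if "t \<in> {s..r}" for t
      using f(2)[of t] s that by auto
    have cont: "continuous_on {s..r} (\<lambda>t. f t powr q)"
      using s fnz by (intro continuous_intros continuous_on_subset[OF f(1)]) auto
    have hb: "h \<in> borel_measurable borel"
      using borel_measurable_continuous_on_indicator[OF _ cont] by (simp add: h_def[abs_def])
    have "(\<integral>\<^sup>+t. ennreal (h t) \<partial>distr (lborel :: 'a measure) borel norm) =
          (\<integral>\<^sup>+x. ennreal (h (norm (x::'a))) \<partial>lborel)"
      using hb by (subst nn_integral_distr) auto
    also have "\<dots> = (\<integral>\<^sup>+x. ennreal (h (norm (x::'a))) \<partial>lebesgue)"
      by (simp add: nn_integral_completion)
    also have "\<dots> \<le> (\<integral>\<^sup>+x. ennreal (norm (u x) powr q) \<partial>lebesgue)"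
    proof (intro nn_integral_mono ennreal_leI)
      fix x :: 'a
      show "h (norm x) \<le> norm (u x) powr q"
      proof (cases "x = 0")
        case True then show ?thesis using s by (simp add: h_def)
      next
        case False
        then show ?thesis using uf[OF False] f(2)[of "norm x"]
          by (auto simp: h_def split: split_indicator)
      qed
    qed
    finally have le: "(\<integral>\<^sup>+t. ennreal (h t) \<partial>distr (lborel :: 'a measure) borel norm) \<le> ennreal I"
      by (simp only: I)
    let ?g = "\<lambda>t. c * (t powr (real ?n - 1) * f t powr q)"
    have "continuous_on {s..r} ?g"
      using s fnz by (intro continuous_intros continuous_on_subset[OF f(1)]) auto
    then have "(?g has_integral integral {s..r} ?g) {s..r}"
      by (intro integrable_integral integrable_continuous_interval)
    then have "(\<integral>\<^sup>+t. ennreal (?g t) * indicator {s..r} t \<partial>lborel) = ennreal (integral {s..r} ?g)"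
      using c by (intro nn_integral_has_integral_lebesgue') auto
    moreover have "(\<integral>\<^sup>+t. ennreal (h t) \<partial>distr (lborel :: 'a measure) borel norm) =
        (\<integral>\<^sup>+t. ennreal (?g t) * indicator {s..r} t \<partial>lborel)"
      unfolding distr_norm_lborel
    proof (subst nn_integral_density, goal_cases)
      case 3
      show ?case
      proof (intro nn_integral_cong)
        fix t :: real
        have "t ^ (?n - 1) = t powr (real ?n - 1)" if "t > 0"
          using that by (simp add: powr_realpow[symmetric] of_nat_diff)
        then show "ennreal (real ?n * unit_ball_vol (real ?n) * t ^ (?n - 1)) * indicator {0..} t * ennreal (h t)
              = ennreal (?g t) * indicator {s..r} t"
          using s by (auto simp: h_def c_def ennreal_mult'[symmetric] ac_simps split: split_indicator)
      qed
    qed (use hb in auto)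
    ultimately have "ennreal (integral {s..r} ?g) \<le> ennreal I" using le by simp
    then have "integral {s..r} ?g \<le> I" using \<open>I \<ge> 0\<close> by (simp add: ennreal_le_iff)
    then have "c * integral {s..r} (\<lambda>t. t powr (real ?n - 1) * f t powr q) \<le> I" by simp
    then show ?thesis using c by (simp add: field_simps)
  qed
  then show ?thesis by blast
qed

section \<open>The Laplacian of a radial function\<close>

lemma partial_deriv_eqI:
  "(f has_derivative f') (at x) \<Longrightarrow> partial_deriv i f x = f' i"
  using frechet_derivative_at[of f f' x] by (simp add: partial_deriv_def)

text \<open>
  The point is taken on the ray through a basis vector \<open>b\<close>. There the second derivative in
  direction \<open>b\<close> is that of the profile, while \<open>\<partial>\<^sub>i u (y) = f'(|y|) y\<^sub>i / |y|\<close> contains a factor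
  \<open>y\<^sub>i\<close> that vanishes on the ray for each of the other directions \<open>i\<close>; each of them therefore
  contributes just \<open>f'(t) / t\<close>.
\<close>

lemma radial_laplacian:
  fixes u :: "'a::euclidean_space \<Rightarrow> real" and f :: "real \<Rightarrow> real"
  assumes C2: "Ck_on 2 (- {0}) u" and uf: "\<And>x. x \<noteq> 0 \<Longrightarrow> u x = f (norm x)" and b: "b \<in> Basis"
  defines "f1 \<equiv> (\<lambda>t. partial_deriv b u (t *\<^sub>R b))"
    and "f2 \<equiv> (\<lambda>t. partial_deriv b (partial_deriv b u) (t *\<^sub>R b))"
  assumes t: "t > 0"
  shows "(f has_real_derivative f1 t) (at t)" and "(f1 has_real_derivative f2 t) (at t)"
    and "laplacian u (t *\<^sub>R b) = f2 t + (real DIM('a) - 1) / t * f1 t"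
proof -
  have nb: "norm b = 1" using b by simp
  have b0: "s *\<^sub>R b \<noteq> 0" if "s > 0" for s using b that by auto
  have along_ray: "((\<lambda>s. v (s *\<^sub>R b)) has_real_derivative partial_deriv b v (s *\<^sub>R b)) (at s)"
    if "v differentiable (at (s *\<^sub>R b))" for v :: "'a \<Rightarrow> real" and s
  proof -
    have v: "(v has_derivative frechet_derivative v (at (s *\<^sub>R b))) (at (s *\<^sub>R b))"
      using that frechet_derivative_works by blast
    then have "((\<lambda>s. v (s *\<^sub>R b)) has_derivative
        (\<lambda>h. frechet_derivative v (at (s *\<^sub>R b)) (h *\<^sub>R b))) (at s)"
      by (intro has_derivative_compose[of "\<lambda>s. s *\<^sub>R b" _ s _ v]) (auto intro!: derivative_eq_intros)
    then show ?thesis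
      by (simp add: has_field_derivative_def partial_deriv_def mult.commute[of _ "frechet_derivative _ _ _"]
          linear_cmul[OF has_derivative_linear[OF v]] mult_commute_abs)
  qed
  have diffu: "u differentiable (at x)" if "x \<noteq> 0" for x
    using C2 that by (simp add: numeral_2_eq_2)
  have diffdu: "partial_deriv i u differentiable (at x)" if "x \<noteq> 0" "i \<in> Basis" for x i
    using C2 that by (simp add: numeral_2_eq_2)
  have f1: "(f has_real_derivative f1 s) (at s)" if "s > 0" for s
  proof -
    have "u (t *\<^sub>R b) = f t" if "t \<in> {0<..}" for t
      using uf[OF b0[of t]] nb that by simp
    with along_ray[OF diffu[OF b0[OF that]]] show ?thesis
      using that unfolding f1_def has_field_derivative_def
      by (auto intro: has_derivative_transform_within_open[of _ _ _ UNIV "{0<..}"])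
  qed
  show "(f has_real_derivative f1 t) (at t)" by (rule f1[OF t])
  show f2: "(f1 has_real_derivative f2 t) (at t)"
    using along_ray[OF diffdu[OF b0[OF t] b]] by (simp add: f1_def f2_def)
  have du: "partial_deriv i u x = f1 (norm x) / norm x * (x \<bullet> i)" if "x \<noteq> 0" for x i
  proof -
    have "((\<lambda>y. f (norm y)) has_derivative (\<lambda>h. f1 (norm x) * (h \<bullet> sgn x))) (at x)"
      using has_derivative_compose[OF has_derivative_norm[OF that], of f "(*) (f1 (norm x))"]
        f1[of "norm x"] that by (simp add: has_field_derivative_def)
    then have "(u has_derivative (\<lambda>h. f1 (norm x) * (h \<bullet> sgn x))) (at x)"
      by (rule has_derivative_transform_within_open[where s="- {0}"]) (use that in \<open>auto simp: uf\<close>)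
    from partial_deriv_eqI[OF this] show ?thesis
      by (simp add: sgn_div_norm inner_commute divide_inverse)
  qed
  have ddu: "partial_deriv i (partial_deriv i u) (t *\<^sub>R b) = f1 t / t" if i: "i \<in> Basis - {b}" for i
  proof -
    have ib: "b \<bullet> i = 0" using i b by (auto simp: inner_Basis)
    have nt: "norm (t *\<^sub>R b) = t" using nb t by simp
    have q: "((\<lambda>s. f1 s / s) has_real_derivative (f2 t * t - f1 t) / (t * t)) (at t)"
      using f2 t by (auto intro!: derivative_eq_intros)
    have "((\<lambda>y. f1 (norm y) / norm y) has_derivative
        (\<lambda>h. (f2 t * t - f1 t) / (t * t) * (h \<bullet> sgn (t *\<^sub>R b)))) (at (t *\<^sub>R b))"
      by (rule has_derivative_compose[OF has_derivative_norm[OF b0[OF t]], of "\<lambda>s. f1 s / s" "(*) ((f2 t * t - f1 t) / (t * t))", unfolded nt])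
         (use q in \<open>simp add: has_field_derivative_def\<close>)
    from has_derivative_mult[OF this, of "\<lambda>y. y \<bullet> i" "\<lambda>h. h \<bullet> i"]
    have "((\<lambda>y. f1 (norm y) / norm y * (y \<bullet> i)) has_derivative (\<lambda>h. f1 t / t * (h \<bullet> i))) (at (t *\<^sub>R b))"
      unfolding nt using ib by (auto intro!: bounded_linear_imp_has_derivative bounded_linear_inner_left)
    then have "(partial_deriv i u has_derivative (\<lambda>h. f1 t / t * (h \<bullet> i))) (at (t *\<^sub>R b))"
      by (rule has_derivative_transform_within_open[where s="- {0}"]) (use b0[OF t] in \<open>auto simp: du\<close>)
    from partial_deriv_eqI[OF this, of i] show ?thesis using i by simp
  qed
  have "laplacian u (t *\<^sub>R b) = f2 t + (\<Sum>i\<in>Basis - {b}. f1 t / t)"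
    unfolding laplacian_def using b ddu by (simp add: sum.remove[OF _ b] f2_def)
  then show "laplacian u (t *\<^sub>R b) = f2 t + (real DIM('a) - 1) / t * f1 t"
    using b by (simp add: card_Diff_singleton of_nat_diff)
qed

section \<open>The flux of a radial solution near the origin\<close>

text \<open>
  On \<open>(0, r]\<close> the measure \<open>t^(n-1) dt\<close> is finite, so \<open>L^q\<close> controls \<open>L^\<sigma>\<close> there; the elementary
  inequality \<open>x^\<sigma> \<le> 1 + x^q\<close> does the work of Hoelder's inequality. Applied to the scale-invariant
  quantity
  \<open>x = r^(n/q) f(t)\<close>, it makes both resulting terms of the same order
  \<open>r^(n - n\<sigma>/q)\<close>.
\<close>

lemma flux_increment_bound:
  fixes f w w' :: "real \<Rightarrow> real" and n q \<sigma> K :: real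
  assumes n: "n > 0" and \<sigma>: "0 \<le> \<sigma>" "\<sigma> \<le> q" "q > 0"
    and f: "continuous_on {0<..} f" "\<And>t. t > 0 \<Longrightarrow> f t > 0"
    and w: "\<And>t. t > 0 \<Longrightarrow> (w has_real_derivative w' t) (at t)"
    and w': "\<And>t. t > 0 \<Longrightarrow> w' t \<ge> - (t powr (n - 1) * f t powr \<sigma>)"
    and K: "\<And>s r. 0 < s \<Longrightarrow> s \<le> r \<Longrightarrow> integral {s..r} (\<lambda>t. t powr (n - 1) * f t powr q) \<le> K"
    and sr: "0 < s" "s \<le> r"
  shows "w r \<ge> w s - (1 / n + K) * r powr (n - n * \<sigma> / q)"
proof -
  define \<beta> where "\<beta> = n * \<sigma> / q"
  have young: "f t powr \<sigma> \<le> r powr (- \<beta>) * (1 + r powr n * f t powr q)" if "t > 0" for t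
  proof -
    define x where "x = r powr (n / q) * f t"
    have r: "r > 0" using sr by simp
    have x: "x > 0" using f(2)[OF that] r by (simp add: x_def)
    have "x powr \<sigma> \<le> 1 + x powr q"
    proof (cases "x \<le> 1")
      case True
      then have "x powr \<sigma> \<le> 1" using x \<sigma> by (intro powr_le1) auto
      then show ?thesis using powr_ge_zero[of x q] by linarith
    next
      case False
      then have "x powr \<sigma> \<le> x powr q" using \<sigma> by (intro powr_mono) auto
      then show ?thesis by simp
    qed
    moreover have "x powr \<sigma> = r powr \<beta> * f t powr \<sigma>" "x powr q = r powr n * f t powr q"
      using r f(2)[OF that] \<sigma> by (simp_all add: x_def powr_mult powr_powr \<beta>_def field_simps)
    ultimately have "r powr \<beta> * f t powr \<sigma> \<le> 1 + r powr n * f t powr q" by simp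
    then have "r powr (-\<beta>) * (r powr \<beta> * f t powr \<sigma>) \<le> r powr (-\<beta>) * (1 + r powr n * f t powr q)"
      by (intro mult_left_mono) auto
    moreover have "r powr (-\<beta>) * r powr \<beta> = 1" using r by (simp flip: powr_add)
    ultimately show ?thesis by (simp flip: mult.assoc)
  qed
  let ?E = "\<lambda>t. t powr (n - 1) * f t powr q"
  let ?F = "\<lambda>t. r powr (-\<beta>) * (t powr (n - 1) + r powr n * ?E t)"
  have fnz: "f t \<noteq> 0" if "t \<in> {s..r}" for t
    using f(2)[of t] sr that by auto
  have contE: "continuous_on {s..r} ?E"
    using sr fnz by (intro continuous_intros continuous_on_subset[OF f(1)]) auto
  have "((\<lambda>t. t powr (n - 1)) has_integral (r powr n / n - s powr n / n)) {s..r}"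
    using sr n by (intro fundamental_theorem_of_calculus)
      (auto intro!: derivative_eq_intros simp flip: has_real_derivative_iff_has_vector_derivative)
  moreover have "(?E has_integral integral {s..r} ?E) {s..r}"
    by (intro integrable_integral integrable_continuous_interval contE)
  ultimately have F: "(?F has_integral
      r powr (-\<beta>) * ((r powr n / n - s powr n / n) + r powr n * integral {s..r} ?E)) {s..r}"
    by (intro has_integral_mult_right has_integral_add)
  have W: "((\<lambda>t. - w' t) has_integral (- w r - (- w s))) {s..r}"
  proof (rule fundamental_theorem_of_calculus[OF sr(2)])
    fix t assume "t \<in> {s..r}"
    then have "((\<lambda>t. - w t) has_real_derivative - w' t) (at t within {s..r})"
      using sr by (intro DERIV_minus has_field_derivative_at_within[OF w]) auto
    then show "((\<lambda>t. - w t) has_vector_derivative - w' t) (at t within {s..r})"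
      by (simp add: has_real_derivative_iff_has_vector_derivative)
  qed
  have "- w r - (- w s) \<le>
      r powr (-\<beta>) * ((r powr n / n - s powr n / n) + r powr n * integral {s..r} ?E)"
  proof (rule has_integral_le[OF W F])
    fix t assume "t \<in> {s..r}"
    then have t: "t > 0" using sr by auto
    have "- w' t \<le> t powr (n - 1) * f t powr \<sigma>" using w'[OF t] by simp
    also have "\<dots> \<le> t powr (n - 1) * (r powr (- \<beta>) * (1 + r powr n * f t powr q))"
      using young[OF t] by (intro mult_left_mono) auto
    also have "\<dots> = ?F t" by (simp add: algebra_simps)
    finally show "- w' t \<le> ?F t" .
  qed
  also have "\<dots> \<le> r powr (-\<beta>) * (r powr n / n + r powr n * K)"
    using K[OF sr] n by (intro mult_left_mono add_mono) auto
  also have "\<dots> = (1 / n + K) * r powr (n - n * \<sigma> / q)"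
    using sr by (simp add: \<beta>_def powr_diff powr_minus field_simps)
  finally show ?thesis by simp
qed

text \<open>
  If \<open>t^(n-1) f'(t) < - \<epsilon>\<close> for all small \<open>t\<close>, integration gives \<open>f(t) \<ge> c t^(2-n)\<close> near
  \<open>0\<close>. The condition \<open>q (n - 2) \<ge> n\<close> is exactly what makes
  \<open>\<integral> t^(n-1) (t^(2-n))^q dt\<close> diverge at \<open>0\<close>, at least logarithmically.
\<close>

lemma flux_not_bounded_away_below:
  fixes f f1 :: "real \<Rightarrow> real" and n q K \<epsilon> \<delta> :: real
  assumes n: "n > 2" and q: "q * (n - 2) \<ge> n"
    and f: "\<And>t. t > 0 \<Longrightarrow> f t > 0" "\<And>t. t > 0 \<Longrightarrow> (f has_real_derivative f1 t) (at t)"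
    and K: "\<And>s r. 0 < s \<Longrightarrow> s \<le> r \<Longrightarrow> integral {s..r} (\<lambda>t. t powr (n - 1) * f t powr q) \<le> K"
    and \<epsilon>: "\<epsilon> > 0" and \<delta>: "\<delta> > 0"
  shows "\<exists>s. 0 < s \<and> s < \<delta> \<and> s powr (n - 1) * f1 s \<ge> - \<epsilon>"
proof (rule ccontr)
  assume "\<not> ?thesis"
  then have neg: "s powr (n - 1) * f1 s < - \<epsilon>" if "0 < s" "s < \<delta>" for s
    using that by force
  define d where "d = min 1 (\<delta> / 2)"
  have d: "0 < d" "d < \<delta>" "d \<le> 1" using \<delta> by (auto simp: d_def)
  define a where "a = \<epsilon> / (n - 2)"
  have a: "a > 0" using n \<epsilon> by (simp add: a_def)
  have lower: "f s \<ge> a * (s powr (2 - n) - d powr (2 - n))" if s: "0 < s" "s \<le> d" for s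
  proof -
    have "f d - a * d powr (2 - n) \<le> f s - a * s powr (2 - n)"
    proof (rule DERIV_nonpos_imp_nonincreasing[OF s(2)])
      fix x assume x: "s \<le> x" "x \<le> d"
      then have x0: "x > 0" "x < \<delta>" using s d by auto
      have "((\<lambda>s. f s - a * s powr (2 - n)) has_real_derivative
          (f1 x - a * ((2 - n) * x powr (2 - n - 1)))) (at x)"
        using x0 f(2)[OF x0(1)] by (auto intro!: derivative_eq_intros)
      moreover have "f1 x - a * ((2 - n) * x powr (2 - n - 1)) \<le> 0"
      proof -
        have "x powr (2 - n - 1) = 1 / x powr (n - 1)"
          using x0 by (simp flip: powr_minus_divide)
        moreover have "a * (2 - n) = - \<epsilon>" using n by (simp add: a_def field_simps)
        moreover have "f1 x < - \<epsilon> / x powr (n - 1)"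
          using neg[OF x0] x0 by (intro iffD2[OF pos_less_divide_eq]) (auto simp: mult.commute)
        ultimately show ?thesis by (simp flip: mult.assoc)
      qed
      ultimately show "\<exists>y. ((\<lambda>s. f s - a * s powr (2 - n)) has_real_derivative y) (at x) \<and> y \<le> 0"
        by blast
    qed
    moreover have "f d > 0" using f d by simp
    ultimately show ?thesis by (simp add: algebra_simps)
  qed
  \<comment> \<open>Below \<open>e\<close>, where \<open>s^(2-n)\<close> is at least twice \<open>d^(2-n)\<close>, the constant \<open>d^(2-n)\<close> costs at most
      half of the main term.\<close>
  define e where "e = d * 2 powr (- 1 / (n - 2))"
  have "2 powr (- 1 / (n - 2)) \<le> (1::real)"
    using n powr_mono[of "- 1 / (n - 2)" 0 "2::real"] by (simp add: divide_nonpos_pos)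
  then have e: "0 < e" "e \<le> d" using d by (auto simp: e_def mult_left_le)
  have e2: "e powr (2 - n) = 2 * d powr (2 - n)"
  proof -
    have "(- 1 / (n - 2)) * (2 - n) = 1" using n by (simp add: field_simps)
    then show ?thesis using d by (simp add: e_def powr_mult powr_powr)
  qed
  define c where "c = a / 2"
  have c: "c > 0" using a by (simp add: c_def)
  have lower2: "f s \<ge> c * s powr (2 - n)" if s: "0 < s" "s \<le> e" for s
  proof -
    have "e powr (2 - n) \<le> s powr (2 - n)" using s n by (intro powr_mono2') auto
    then have "a * (s powr (2 - n) - d powr (2 - n)) \<ge> a * (s powr (2 - n) / 2)"
      using a e2 by (intro mult_left_mono) auto
    then show ?thesis using lower[of s] s e by (simp add: c_def)
  qed
  have q0: "q > 0"
    using q n by (smt (verit) mult_nonpos_nonneg)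
  have integrand: "t powr (n - 1) * f t powr q \<ge> c powr q * (1 / t)" if t: "0 < t" "t \<le> e" for t
  proof -
    have "c powr q * (1 / t) = t powr (n - 1) * (c powr q * t powr (- n))"
      using t by (simp add: powr_diff powr_minus field_simps)
    also have "\<dots> \<le> t powr (n - 1) * (c powr q * t powr ((2 - n) * q))"
    proof (intro mult_left_mono)
      have "t \<le> 1" "(2 - n) * q \<le> - n" using t e d q by (auto simp: algebra_simps)
      then show "t powr (- n) \<le> t powr ((2 - n) * q)" using t by (intro powr_mono') auto
    qed auto
    also have "c powr q * t powr ((2 - n) * q) = (c * t powr (2 - n)) powr q"
      using t c by (simp add: powr_mult powr_powr)
    also have "\<dots> \<le> f t powr q" using lower2[OF t] c q0 by (intro powr_mono2) auto
    finally show ?thesis by (simp add: mult_left_mono)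
  qed
  \<comment> \<open>The integral of \<open>1/t\<close> over \<open>[s, e]\<close> is \<open>ln (e/s)\<close>; this \<open>s\<close> makes the lower bound for the
      integral equal to \<open>|K| + 1\<close>.\<close>
  define s where "s = e * exp (- (\<bar>K\<bar> + 1) / c powr q)"
  have s: "0 < s" "s \<le> e" using e c by (auto simp: s_def intro!: mult_left_le divide_nonpos_nonneg)
  have contf: "continuous_on {s..e} f"
    using s by (intro continuous_at_imp_continuous_on ballI DERIV_isCont[OF f(2)]) auto
  have contE: "continuous_on {s..e} (\<lambda>t. t powr (n - 1) * f t powr q)"
  proof -
    have "f t \<noteq> 0" if "t \<in> {s..e}" for t using f(1)[of t] s that by auto
    then show ?thesis using s by (intro continuous_intros contf) auto
  qed
  have "((\<lambda>t. c powr q * (1 / t)) has_integral (c powr q * (ln e - ln s))) {s..e}"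
    using s by (intro has_integral_mult_right fundamental_theorem_of_calculus)
      (auto intro!: derivative_eq_intros simp flip: has_real_derivative_iff_has_vector_derivative)
  then have "c powr q * (ln e - ln s) \<le> integral {s..e} (\<lambda>t. t powr (n - 1) * f t powr q)"
    by (rule has_integral_le[OF _ integrable_integral[OF integrable_continuous_interval[OF contE]]])
       (use integrand s in auto)
  moreover have "c powr q * (ln e - ln s) = \<bar>K\<bar> + 1"
    using e c by (simp add: s_def ln_mult)
  ultimately show False using K[OF s] by linarith
qed

text \<open>
  The flux is compared with its value at some \<open>s\<close> much closer to the origin, where it is at
  least \<open>- \<epsilon>\<close>; letting \<open>\<epsilon>\<close> tend to \<open>0\<close> leaves only the increment bound.
\<close>

lemma radial_solution_derivative_bound:
  fixes f f1 f2 :: "real \<Rightarrow> real" and n A \<alpha> p :: real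
  defines "q \<equiv> 2 * n / (n - 2)"
  defines "\<beta> \<equiv> (n - 2) / 2 * (p - 1)"
  assumes n: "n > 2" and A: "A \<ge> 0" and p: "1 \<le> p" "p \<le> q + 1"
    and f: "\<And>t. t > 0 \<Longrightarrow> f t > 0"
    and f1: "\<And>t. t > 0 \<Longrightarrow> (f has_real_derivative f1 t) (at t)"
    and f2: "\<And>t. t > 0 \<Longrightarrow> (f1 has_real_derivative f2 t) (at t)"
    and ode: "\<And>t. t > 0 \<Longrightarrow> - (f2 t + (n - 1) / t * f1 t) + A / t powr \<alpha> * f t = f t powr (p - 1)"
    and K: "\<And>s r. 0 < s \<Longrightarrow> s \<le> r \<Longrightarrow> integral {s..r} (\<lambda>t. t powr (n - 1) * f t powr q) \<le> K"
  shows "\<exists>C\<ge>0. \<forall>t. 0 < t \<and> t \<le> 1 \<longrightarrow> f1 t \<ge> - C * t powr (1 - \<beta>)"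
proof (intro exI[of _ "\<bar>1 / n + K\<bar>"] conjI allI impI)
  show "0 \<le> \<bar>1 / n + K\<bar>" by simp
  define w where "w t = t powr (n - 1) * f1 t" for t
  define w' where "w' t = t powr (n - 1) * (f2 t + (n - 1) / t * f1 t)" for t
  have q: "q > 0" "q * (n - 2) \<ge> n" using n by (auto simp: q_def)
  have \<beta>: "n * (p - 1) / q = \<beta>" using n by (simp add: q_def \<beta>_def field_simps)
  have w: "(w has_real_derivative w' t) (at t)" if "t > 0" for t
  proof -
    have "(w has_real_derivative (n - 1) * t powr (n - 1 - 1) * f1 t + f2 t * t powr (n - 1)) (at t)"
      unfolding w_def[abs_def] using that
      by (intro DERIV_mult f2) (auto intro!: derivative_eq_intros)
    moreover have "t powr (n - 1 - 1) = t powr (n - 1) / t"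
      using that powr_diff[of t "n - 1" 1] by simp
    ultimately show ?thesis by (simp add: w'_def algebra_simps diff_divide_distrib)
  qed
  have w'_ge: "w' t \<ge> - (t powr (n - 1) * f t powr (p - 1))" if t: "t > 0" for t
  proof -
    have "A / t powr \<alpha> * f t \<ge> 0" using A f[OF t] by simp
    then have "f2 t + (n - 1) / t * f1 t \<ge> - (f t powr (p - 1))" using ode[OF t] by linarith
    then have "t powr (n - 1) * (f2 t + (n - 1) / t * f1 t) \<ge> t powr (n - 1) * - (f t powr (p - 1))"
      by (rule mult_left_mono) simp
    then show ?thesis by (simp add: w'_def)
  qed
  have contf: "continuous_on {0<..} f"
    using f1 by (intro continuous_at_imp_continuous_on ballI DERIV_isCont) auto
  fix r :: real assume r: "0 < r \<and> r \<le> 1"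
  have "w r \<ge> - ((1 / n + K) * r powr (n - \<beta>)) - \<epsilon>" if \<epsilon>: "\<epsilon> > 0" for \<epsilon>
  proof -
    obtain s where s: "0 < s" "s < r" "w s \<ge> - \<epsilon>"
      using flux_not_bounded_away_below[OF n q(2) f f1 K \<epsilon>, of r] r by (auto simp: w_def)
    have "w r \<ge> w s - (1 / n + K) * r powr (n - n * (p - 1) / q)"
      using n p q s by (intro flux_increment_bound[OF _ _ _ _ contf f w w'_ge K]) auto
    then show ?thesis using s by (simp add: \<beta>)
  qed
  then have "w r \<ge> - ((1 / n + K) * r powr (n - \<beta>))"
    by (smt (verit) field_le_epsilon)
  moreover have "(1 / n + K) * r powr (n - \<beta>) \<le> \<bar>1 / n + K\<bar> * r powr (n - \<beta>)"
    by (intro mult_right_mono) auto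
  moreover have "r powr (n - \<beta>) = r powr (n - 1) * r powr (1 - \<beta>)"
    by (simp flip: powr_add)
  ultimately have "r powr (n - 1) * (- \<bar>1 / n + K\<bar> * r powr (1 - \<beta>)) \<le> r powr (n - 1) * f1 r"
    by (simp add: w_def mult_ac)
  then show "f1 r \<ge> - \<bar>1 / n + K\<bar> * r powr (1 - \<beta>)"
    by (rule mult_left_le_imp_le) (use r in auto)
qed

section \<open>From the flux to the growth of the solution\<close>

lemma growth_from_derivative_bound:
  fixes f f1 :: "real \<Rightarrow> real" and C \<beta> r :: real
  assumes f: "\<And>t. t > 0 \<Longrightarrow> (f has_real_derivative f1 t) (at t)"
    and f1: "\<And>t. 0 < t \<Longrightarrow> t \<le> 1 \<Longrightarrow> f1 t \<ge> - C * t powr (1 - \<beta>)"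
    and r: "0 < r" "r \<le> 1"
  shows "\<beta> = 2 \<Longrightarrow> f r \<le> f 1 - C * ln r"
    and "\<beta> \<noteq> 2 \<Longrightarrow> f r \<le> f 1 + C * (1 - r powr (2 - \<beta>)) / (2 - \<beta>)"
proof -
  have compare: "f r + C * P r \<le> f 1 + C * P 1"
    if P: "\<And>t. t > 0 \<Longrightarrow> (P has_real_derivative t powr (1 - \<beta>)) (at t)" for P
  proof (rule DERIV_nonneg_imp_nondecreasing[OF r(2)])
    fix x assume "r \<le> x" "x \<le> 1"
    then have x: "0 < x" "x \<le> 1" using r by auto
    have "((\<lambda>t. f t + C * P t) has_real_derivative f1 x + C * x powr (1 - \<beta>)) (at x)"
      using f[OF x(1)] P[OF x(1)] by (auto intro!: derivative_eq_intros)
    then show "\<exists>y. ((\<lambda>t. f t + C * P t) has_real_derivative y) (at x) \<and> 0 \<le> y"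
      using f1[OF x] by force
  qed
  show "f r \<le> f 1 - C * ln r" if "\<beta> = 2"
  proof -
    have "(ln has_real_derivative t powr (1 - \<beta>)) (at t)" if "t > 0" for t
      using DERIV_ln_divide[OF that] that \<open>\<beta> = 2\<close> by (simp add: powr_minus_divide)
    from compare[OF this] show ?thesis by simp
  qed
  show "f r \<le> f 1 + C * (1 - r powr (2 - \<beta>)) / (2 - \<beta>)" if "\<beta> \<noteq> 2"
  proof -
    have "((\<lambda>t. t powr (2 - \<beta>) / (2 - \<beta>)) has_real_derivative t powr (1 - \<beta>)) (at t)" if "t > 0" for t
      using that \<open>\<beta> \<noteq> 2\<close> by (auto intro!: derivative_eq_intros)
    from compare[OF this] show ?thesis by (simp add: diff_divide_distrib right_diff_distrib)
  qed
qed

theorem theorem3: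
  fixes N :: nat and A \<alpha> p :: real and u :: "'a::euclidean_space \<Rightarrow> real"
  assumes "DIM('a) = N" and "N \<ge> 3"
    and "A > 0" and "0 < \<alpha>" and "\<alpha> < 2"
    and "2 * real N / (real N - \<alpha>) < p" and "p < critical_exponent N"
    and "classical_solution A \<alpha> p u" and "radial u"
  shows "(p < critical_exponent N - 1 \<longrightarrow> u \<in> O[at 0](\<lambda>x. 1)) \<and>
         (p = critical_exponent N - 1 \<longrightarrow> u \<in> O[at 0](\<lambda>x. ln (norm x))) \<and>
         (p > critical_exponent N - 1 \<longrightarrow>
            u \<in> O[at 0](\<lambda>x. norm x powr (- ((real N - 2) / 2 * (p - critical_exponent N + 1)))))"
proof -
  define n where "n = real N"
  define q where "q = 2 * n / (n - 2)"
  define \<beta> where "\<beta> = (n - 2) / 2 * (p - 1)"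
  have n: "n > 2" and nN: "n = real DIM('a)" using assms by (auto simp: n_def)
  have q: "critical_exponent N = q" by (simp add: critical_exponent_def q_def n_def)
  have p: "1 \<le> p"
  proof -
    have "2 \<le> 2 * n / (n - \<alpha>)" using n assms(4,5) by (simp add: field_simps)
    then show ?thesis using assms(6) by (simp add: n_def)
  qed
  have \<beta>q: "\<beta> - 2 = (n - 2) / 2 * (p - q + 1)"
    using n by (simp add: \<beta>_def q_def field_simps)
  obtain f where uf: "\<And>x. x \<noteq> 0 \<Longrightarrow> u x = f (norm x)"
    using assms(9) by (auto simp: radial_def)
  have C2: "Ck_on 2 (- {0}) u" and pos: "\<And>x. x \<noteq> 0 \<Longrightarrow> u x > 0"
    and eq: "\<And>x. x \<noteq> 0 \<Longrightarrow> - laplacian u x + A / (norm x powr \<alpha>) * u x = u x powr (p - 1)"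
    and Lq: "u \<in> Lp_space lebesgue q"
    using assms(8) assms(1) q by (auto simp: classical_solution_def H1_weighted_def D12_def)
  obtain b :: 'a where b: "b \<in> Basis" using nonempty_Basis by blast
  have nb: "t *\<^sub>R b \<noteq> 0" "norm (t *\<^sub>R b) = t" if "t > 0" for t using b that by auto
  define f1 where "f1 t = partial_deriv b u (t *\<^sub>R b)" for t
  define f2 where "f2 t = partial_deriv b (partial_deriv b u) (t *\<^sub>R b)" for t
  note rad = radial_laplacian[OF C2 uf b, folded f1_def f2_def nN]
  have fpos: "f t > 0" if "t > 0" for t
    using pos[of "t *\<^sub>R b"] uf[of "t *\<^sub>R b"] nb[OF that] by simp
  have ode: "- (f2 t + (n - 1) / t * f1 t) + A / t powr \<alpha> * f t = f t powr (p - 1)" if "t > 0" for t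
    using eq[OF nb(1)[OF that]] uf[OF nb(1)[OF that]] rad(3)[OF _ that] nb(2)[OF that] by simp
  have contf: "continuous_on {0<..} f"
    using rad(1) by (intro continuous_at_imp_continuous_on ballI DERIV_isCont) auto
  obtain K where K: "\<And>s r. 0 < s \<Longrightarrow> s \<le> r \<Longrightarrow> integral {s..r} (\<lambda>t. t powr (n - 1) * f t powr q) \<le> K"
    using radial_integral_bound[OF Lq uf contf fpos] unfolding nN by blast
  obtain C where C: "C \<ge> 0" and f1: "\<And>t. 0 < t \<Longrightarrow> t \<le> 1 \<Longrightarrow> f1 t \<ge> - C * t powr (1 - \<beta>)"
    using radial_solution_derivative_bound[OF n _ p _ fpos rad(1,2) ode, folded q_def \<beta>_def, of K] K assms(3,7) q
    by (auto simp: \<beta>_def)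
  note growth = growth_from_derivative_bound[OF rad(1) f1]
  have bigo: "u \<in> O[at 0](g)"
    if "d > 0" and "\<And>x. x \<noteq> 0 \<Longrightarrow> norm x < d \<Longrightarrow> f (norm x) \<le> M * \<bar>g x\<bar>"
    for g :: "'a \<Rightarrow> real" and M d :: real
  proof (rule bigoI[where c = M])
    show "\<forall>\<^sub>F x in at 0. norm (u x) \<le> M * norm (g x)"
      unfolding eventually_at using that pos uf
      by (intro exI[of _ d]) (auto simp: less_imp_le)
  qed
  show ?thesis
    unfolding q
  proof (intro conjI impI)
    assume "p < q - 1"
    then have \<beta>: "\<beta> < 2" using \<beta>q n by (smt (verit) divide_pos_pos mult_pos_neg)
    show "u \<in> O[at 0](\<lambda>x. 1)"
    proof (rule bigo[of 1 "f 1 + C / (2 - \<beta>)"])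
      fix x :: 'a assume x: "x \<noteq> 0" "norm x < 1"
      have "C * (1 - norm x powr (2 - \<beta>)) / (2 - \<beta>) \<le> C / (2 - \<beta>)"
        using C \<beta> by (intro divide_right_mono) (auto simp: mult_left_le)
      then show "f (norm x) \<le> (f 1 + C / (2 - \<beta>)) * \<bar>1\<bar>"
        using growth(2)[of "norm x"] x \<beta> by force
    qed simp
  next
    assume "p = q - 1"
    then have \<beta>: "\<beta> = 2" using \<beta>q by simp
    show "u \<in> O[at 0](\<lambda>x. ln (norm x))"
    \<comment> \<open>For \<open>|x| < 1/e\<close> the logarithm exceeds \<open>1\<close> in absolute value and absorbs the constant \<open>f 1\<close>.\<close>
    proof (rule bigo[of "exp (- 1)" "f 1 + C"])
      fix x :: 'a assume x: "x \<noteq> 0" "norm x < exp (- 1)"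
      then have ln: "ln (norm x) < - 1" by (metis exp_gt_zero ln_exp ln_less_cancel_iff zero_less_norm_iff)
      have "norm x \<le> 1" using x by (smt (verit) exp_le_one_iff)
      then have "f (norm x) \<le> f 1 - C * ln (norm x)" using growth(1)[of "norm x"] x \<beta> by simp
      also have "\<dots> \<le> f 1 * \<bar>ln (norm x)\<bar> + C * \<bar>ln (norm x)\<bar>"
        using mult_left_mono[of 1 "\<bar>ln (norm x)\<bar>" "f 1"] ln fpos[of 1] by simp
      finally show "f (norm x) \<le> (f 1 + C) * \<bar>ln (norm x)\<bar>" by (simp add: algebra_simps)
    qed simp
  next
    assume "p > q - 1"
    then have \<beta>: "\<beta> > 2" using \<beta>q n by (smt (verit) divide_pos_pos mult_pos_pos)
    have *: "- ((real N - 2) / 2 * (p - q + 1)) = 2 - \<beta>" using \<beta>q by (simp add: n_def)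
    show "u \<in> O[at 0](\<lambda>x. norm x powr (- ((real N - 2) / 2 * (p - q + 1))))"
      unfolding *
    proof (rule bigo[of 1 "f 1 + C / (\<beta> - 2)"])
      fix x :: 'a assume x: "x \<noteq> 0" "norm x < 1"
      let ?y = "norm x powr (2 - \<beta>)"
      have y: "?y \<ge> 1" using x \<beta> by (simp add: ge_one_powr_ge_zero powr_mono2'[of "2 - \<beta>" "norm x" 1, simplified])
      have "C * (1 - ?y) / (2 - \<beta>) = C / (\<beta> - 2) * (?y - 1)"
        using \<beta> by (simp add: field_simps)
      also have "\<dots> \<le> C / (\<beta> - 2) * ?y" using C \<beta> by (intro mult_left_mono) auto
      finally have "f (norm x) \<le> f 1 + C / (\<beta> - 2) * ?y"
        using growth(2)[of "norm x"] x \<beta> by force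
      also have "\<dots> \<le> f 1 * ?y + C / (\<beta> - 2) * ?y" using y fpos[of 1] by simp
      finally show "f (norm x) \<le> (f 1 + C / (\<beta> - 2)) * \<bar>?y\<bar>" by (simp add: algebra_simps)
    qed simp
  qed
qed

end
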